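(* Let $l\geq 2$ be a natural number, let $P_1,P_2,\ldots,P_l$ be non-zero complex polynomials (possibly constant), and let $Q_1,Q_2,\ldots,Q_{l-1}$ be non-constant complex polynomials such that $\deg(Q_i)\neq\deg(Q_j)$ for $i\neq j$. Then the entire function $$P_1\exp(Q_1)+P_2\exp(Q_2)+\cdots+P_{l-1}\exp(Q_{l-1})+P_l$$ does not have any Baker wandering domain.
   Context: For an entire function $f$, the Fatou set is the set of points at which the sequence of iterates $\{f^n\}_{n\ge1}$ forms a normal family, and a Fatou component is a maximal connected subset of the Fatou set. For a Fatou component $U$, $U_n$ denotes the Fatou component containing $f^n(U)$. A Fatou component $W$ is a wandering domain if $W_n\cap W_m=\emptyset$ for all $m\neq n$. For subsets $A,B$ of $\mathbb C$, $A$ surrounds $B$ if some bounded component of $\widehat{\mathbb C}\setminus A$ contains $B$. A wandering domain $W$ is called a Baker wandering domain of $f$ if each $W_n$ is bounded and multiply connected, there exists a natural number $N$ such that $W_{n+1}$ surrounds $W_n$ and $0$ for all $n\geq N$, and $f^n(z)\to\infty$ as $n\to\infty$ for all $z\in W$. *)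

theory Defs
  imports "HOL-Complex_Analysis.Complex_Analysis"
begin

text \<open>Normality in the sense of Montel, with \<open>\<infinity>\<close> admitted as a limit (equivalently,
  normality with respect to the spherical metric).  It is meant for families of holomorphic
  functions on a domain \<open>D\<close>, where the limit is holomorphic or identically \<open>\<infinity>\<close>.\<close>

definition normal_family_on :: "(complex \<Rightarrow> complex) set \<Rightarrow> complex set \<Rightarrow> bool" where
  "normal_family_on F D \<longleftrightarrow>
     (\<forall>g :: nat \<Rightarrow> complex \<Rightarrow> complex. range g \<subseteq> F \<longrightarrow>
        (\<exists>r :: nat \<Rightarrow> nat. strict_mono r \<and>
           ((\<exists>h. h holomorphic_on D \<and>
                 (\<forall>K. compact K \<and> K \<subseteq> D \<longrightarrow>
                    uniform_limit K (\<lambda>k. g (r k)) h sequentially)) \<or>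
            (\<forall>K. compact K \<and> K \<subseteq> D \<longrightarrow>
                 (\<forall>B. \<forall>\<^sub>F k in sequentially. \<forall>z\<in>K. B < norm (g (r k) z))))))"

definition fatou_set :: "(complex \<Rightarrow> complex) \<Rightarrow> complex set" where
  "fatou_set f =
     {z. \<exists>D. open D \<and> connected D \<and> z \<in> D \<and> normal_family_on {f ^^ n | n. n \<ge> 1} D}"

definition fatou_component :: "(complex \<Rightarrow> complex) \<Rightarrow> complex set \<Rightarrow> bool" where
  "fatou_component f U \<longleftrightarrow> U \<in> components (fatou_set f)"

text \<open>The component \<open>U\<^sub>n\<close> is well defined for entire \<open>f\<close> that are not constant, since the Fatou
  set is then forward invariant.\<close>

definition fatou_image :: "(complex \<Rightarrow> complex) \<Rightarrow> complex set \<Rightarrow> nat \<Rightarrow> complex set" where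
  "fatou_image f U n = (THE V. fatou_component f V \<and> (f ^^ n) ` U \<subseteq> V)"

definition wandering_domain :: "(complex \<Rightarrow> complex) \<Rightarrow> complex set \<Rightarrow> bool" where
  "wandering_domain f W \<longleftrightarrow>
     fatou_component f W \<and>
     (\<forall>m n. m \<noteq> n \<longrightarrow> fatou_image f W n \<inter> fatou_image f W m = {})"

text \<open>The Riemann sphere is the one-point compactification of the plane; \<open>None\<close> is \<open>\<infinity>\<close>.
  A bounded component of the complement is in particular one that omits \<open>\<infinity>\<close>.\<close>

abbreviation riemann_sphere :: "complex option topology" where
  "riemann_sphere \<equiv> Alexandroff_compactification euclidean"

definition surrounds :: "complex set \<Rightarrow> complex set \<Rightarrow> bool" where
  "surrounds A B \<longleftrightarrow>
     (\<exists>C. bounded C \<and> B \<subseteq> C \<and>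
          Some ` C \<in> connected_components_of
                       (subtopology riemann_sphere (topspace riemann_sphere - Some ` A)))"

definition multiply_connected :: "complex set \<Rightarrow> bool" where
  "multiply_connected U \<longleftrightarrow> connected U \<and> \<not> simply_connected U"

definition baker_wandering_domain :: "(complex \<Rightarrow> complex) \<Rightarrow> complex set \<Rightarrow> bool" where
  "baker_wandering_domain f W \<longleftrightarrow>
     wandering_domain f W \<and>
     (\<forall>n. bounded (fatou_image f W n) \<and> multiply_connected (fatou_image f W n)) \<and>
     (\<exists>N. \<forall>n\<ge>N. surrounds (fatou_image f W (Suc n)) (fatou_image f W n) \<and>
                surrounds (fatou_image f W (Suc n)) {0}) \<and>
     (\<forall>z\<in>W. filterlim (\<lambda>n. (f ^^ n) z) at_infinity sequentially)"

end

theory Submission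
  imports Defs "HOL-Real_Asymp.Real_Asymp"
begin

text \<open>Let \<open>d\<close> be the largest degree among the \<open>Q\<^sub>i\<close>, attained by one index only, and let \<open>f\<close> be the
  exponential sum. On a ray where the leading term of the dominant \<open>Q\<^sub>i\<close> is positive,
  \<open>ln |f|\<close> grows like \<open>|z|\<^sup>d\<close>; on a ray where it is negative, \<open>ln |f|\<close> is at most
  \<open>|z|\<close> to the power \<open>d - 1/2\<close>. Such imbalance is incompatible with a multiply connected Fatou
  component \<open>W\<close> on which the iterates escape, for the following reason.

  Normality makes the escape locally uniform, so on a neighbourhood of a loop in \<open>W\<close> the functions
  \<open>ln |f\<^sup>n|\<close> are eventually positive and harmonic. Harnack's inequality bounds their ratios at two
  points by constants independent of \<open>n\<close>, arbitrarily close to \<open>1\<close> at short distance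
  (\<open>harnack_ln_norm_two_points\<close>, \<open>harnack_along_path\<close>). If the loop surrounds a point outside
  \<open>W\<close>, then infinitely many iterates have a zero inside the loop, since otherwise the minimum
  principle would spread the escape to the inside and make it part of \<open>W\<close>
  (\<open>escaping_component_fills_bounded_open\<close>). For such \<open>n\<close> the image of the loop under \<open>f\<^sup>n\<close> hits
  every ray from the origin (\<open>holomorphic_image_frontier_hits_ray\<close>).

  It remains to find points \<open>z\<^sub>1\<close>, \<open>z\<^sub>2\<close> on or near the loop that \<open>f\<^sup>n\<close> sends to the ray of slow
  growth and to the ray of fast growth, with \<open>ln |f\<^sup>n z\<^sub>1|\<close> at most \<open>1 + 1/(2d)\<close> times
  \<open>ln |f\<^sup>n z\<^sub>2|\<close>. If some small ball is mapped so as to meet both rays, short-range Harnack gives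
  this. If every small ball misses one of the rays, then the argument of \<open>f\<^sup>n\<close> varies boundedly on
  it, hence so does \<open>ln |f\<^sup>n|\<close> along the whole loop
  (\<open>oscillation_along_path_if_rays_omitted\<close>), which is negligible for large \<open>n\<close>. One further
  application of \<open>f\<close> then produces values whose logarithms differ by an unbounded factor
  (\<open>ray_growth_gap\<close>), against Harnack's inequality for \<open>f\<^sup>n\<^sup>+\<^sup>1\<close>.\<close>

section \<open>Harnack inequalities for the logarithm of the modulus\<close>

text \<open>The Cayley transform \<open>w \<mapsto> (w - h p) / (w + cnj (h p))\<close> maps the right half-plane to the
  unit disc and \<open>h p\<close> to \<open>0\<close>, so this is the Schwarz lemma for \<open>h\<close> followed by it.\<close>

lemma schwarz_right_half_plane:
  assumes hol: "h holomorphic_on ball p r" and pos: "\<And>z. z \<in> ball p r \<Longrightarrow> Re (h z) > 0"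
    and z: "z \<in> ball p r"
  shows "norm (h z - h p) \<le> dist p z / r * norm (h z + cnj (h p))"
proof -
  have r: "r > 0" using z by (metis ball_eq_empty empty_iff not_less)
  define \<phi> where "\<phi> = (\<lambda>w. (h (p + of_real r * w) - h p) / (h (p + of_real r * w) + cnj (h p)))"
  have inb: "p + of_real r * w \<in> ball p r" if "norm w < 1" for w
    using that r by (simp add: dist_norm norm_mult)
  have p: "Re (h p) > 0" using pos[of p] r by simp
  have nz: "h x + cnj (h p) \<noteq> 0" if "x \<in> ball p r" for x
  proof
    assume "h x + cnj (h p) = 0"
    then have "Re (h x + cnj (h p)) = 0" by simp
    with pos[OF that] p show False by simp
  qed
  have holc: "(\<lambda>w. h (p + of_real r * w)) holomorphic_on ball 0 1"
    by (rule holomorphic_on_compose_gen[OF _ hol, unfolded o_def])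
       (use inb in \<open>auto intro!: holomorphic_intros\<close>)
  have "\<phi> holomorphic_on ball 0 1"
    unfolding \<phi>_def using nz inb by (intro holomorphic_intros holc) auto
  moreover have "\<phi> 0 = 0" by (simp add: \<phi>_def)
  moreover have "norm (\<phi> w) < 1" if "norm w < 1" for w
  proof -
    let ?x = "h (p + of_real r * w)"
    have x: "Re ?x > 0" using pos[OF inb[OF that]] .
    have "norm (?x - h p) ^ 2 < norm (?x + cnj (h p)) ^ 2"
      using mult_pos_pos[OF x p] unfolding cmod_power2 by (simp add: power2_eq_square algebra_simps)
    then have "norm (?x - h p) < norm (?x + cnj (h p))"
      by (rule power2_less_imp_less) simp
    then show ?thesis
      using nz[OF inb[OF that]] by (simp add: \<phi>_def norm_divide divide_less_eq)
  qed
  moreover have zw: "norm ((z - p) / of_real r) < 1"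
    using z r by (simp add: dist_norm norm_divide norm_minus_commute)
  ultimately have "norm (\<phi> ((z - p) / of_real r)) \<le> norm ((z - p) / of_real r)"
    by (rule Schwarz_Lemma(1))
  then show ?thesis
    using nz[OF z] r
    by (simp add: \<phi>_def norm_divide dist_norm norm_minus_commute divide_le_eq)
qed

text \<open>Since \<open>g\<close> omits \<open>0\<close> on the ball, \<open>g = exp h\<close> there, and \<open>Re h = ln (norm g) > 0\<close>. The
  half-plane Schwarz lemma applied to \<open>h\<close> is Harnack's inequality for this positive harmonic
  function. Only the real parts are compared: dropping the imaginary difference is harmless because
  \<open>\<rho> \<le> 1\<close>.\<close>

lemma harnack_ln_norm:
  assumes hol: "g holomorphic_on ball p r" and big: "\<And>z. z \<in> ball p r \<Longrightarrow> norm (g z) > 1"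
    and z: "dist p z \<le> \<rho> * r" and "r > 0" "0 \<le> \<rho>" "\<rho> < 1"
  shows "(1 - \<rho>) * ln (norm (g z)) \<le> (1 + \<rho>) * ln (norm (g p))"
    and "(1 - \<rho>) * ln (norm (g p)) \<le> (1 + \<rho>) * ln (norm (g z))"
proof -
  have "\<rho> * r < r" using assms by simp
  with z have zb: "z \<in> ball p r" by simp
  have nz: "g w \<noteq> 0" if "w \<in> ball p r" for w using big[OF that] by auto
  obtain h where h: "h holomorphic_on ball p r" "\<And>w. w \<in> ball p r \<Longrightarrow> g w = exp (h w)"
    using contractible_imp_holomorphic_log[OF hol _ nz] convex_imp_contractible[OF convex_ball] by metis
  have ln: "ln (norm (g w)) = Re (h w)" if "w \<in> ball p r" for w
    using h(2)[OF that] by simp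
  have pos: "Re (h w) > 0" if "w \<in> ball p r" for w
    using big[OF that] ln[OF that] by (metis ln_gt_zero)
  let ?x = "Re (h z)" and ?y = "Re (h p)" and ?d = "Im (h z) - Im (h p)"
  have xy: "?x > 0" "?y > 0" using pos zb \<open>r > 0\<close> by auto
  have "norm (h z - h p) \<le> dist p z / r * norm (h z + cnj (h p))"
    by (rule schwarz_right_half_plane[OF h(1) pos zb])
  also have "\<dots> \<le> \<rho> * norm (h z + cnj (h p))"
    by (rule mult_right_mono) (use z \<open>r > 0\<close> in \<open>simp_all add: divide_le_eq\<close>)
  finally have "norm (h z - h p) ^ 2 \<le> (\<rho> * norm (h z + cnj (h p))) ^ 2"
    by (rule power_mono) simp
  then have 1: "(?x - ?y)\<^sup>2 + ?d\<^sup>2 \<le> \<rho>\<^sup>2 * ((?x + ?y)\<^sup>2 + ?d\<^sup>2)"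
    by (simp add: cmod_power2 power_mult_distrib)
  have "\<rho>\<^sup>2 * ?d\<^sup>2 \<le> 1 * ?d\<^sup>2"
    by (rule mult_right_mono) (use assms in \<open>simp_all add: power_le_one\<close>)
  with 1 have "(?x - ?y)\<^sup>2 \<le> (\<rho> * (?x + ?y))\<^sup>2"
    unfolding power_mult_distrib distrib_left[of "\<rho>\<^sup>2"] by linarith
  then have "\<bar>?x - ?y\<bar> \<le> \<rho> * (?x + ?y)"
    using xy assms(5) by (intro power2_le_imp_le[of "\<bar>?x - ?y\<bar>"]) auto
  then show "(1 - \<rho>) * ln (norm (g z)) \<le> (1 + \<rho>) * ln (norm (g p))"
    and "(1 - \<rho>) * ln (norm (g p)) \<le> (1 + \<rho>) * ln (norm (g z))"
    using ln[OF zb] ln[of p] \<open>r > 0\<close> by (auto simp: algebra_simps abs_le_iff)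
qed

text \<open>Comparing two points through the centre costs the factor \<open>((1 + \<rho>) / (1 - \<rho>))\<^sup>2\<close>. What matters
  is that the constant tends to \<open>1\<close> with \<open>\<rho>\<close>, uniformly in \<open>g\<close>; the linear bound \<open>1 + 9 \<rho>\<close> is
  convenient.\<close>

lemma harnack_ln_norm_two_points:
  assumes hol: "g holomorphic_on ball p r" and big: "\<And>z. z \<in> ball p r \<Longrightarrow> norm (g z) > 1"
    and "dist p z \<le> \<rho> * r" "dist p w \<le> \<rho> * r" "r > 0" "0 < \<rho>" "\<rho> \<le> 1 / 3"
  shows "ln (norm (g z)) \<le> (1 + 9 * \<rho>) * ln (norm (g w))"
proof -
  let ?z = "ln (norm (g z))" and ?p = "ln (norm (g p))" and ?w = "ln (norm (g w))"
  have *: "a \<le> (1 + 3 * \<rho>) * b"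
    if "(1 - \<rho>) * a \<le> (1 + \<rho>) * b" "b \<ge> 0" for a b :: real
  proof -
    have "3 * (\<rho> * \<rho>) \<le> \<rho>" using assms by (simp add: field_simps)
    then have "1 + \<rho> \<le> (1 - \<rho>) * (1 + 3 * \<rho>)" by (simp add: algebra_simps)
    then have "(1 + \<rho>) * b \<le> (1 - \<rho>) * (1 + 3 * \<rho>) * b" using that(2) by (rule mult_right_mono)
    with that(1) have "(1 - \<rho>) * a \<le> (1 - \<rho>) * ((1 + 3 * \<rho>) * b)" by (simp add: mult.assoc)
    then show ?thesis using assms by simp
  qed
  have "\<rho> * r < r" using assms by simp
  then have "z \<in> ball p r" "w \<in> ball p r" "p \<in> ball p r"
    using assms(3-5) unfolding mem_ball by (linarith, linarith, simp)
  then have nonneg: "?p \<ge> 0" "?w \<ge> 0" using big[THEN less_imp_le] by (auto intro!: ln_ge_zero)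
  have "?z \<le> (1 + 3 * \<rho>) * ?p"
    using harnack_ln_norm(1)[OF hol big, of z \<rho>] assms nonneg by (intro *) auto
  also have "\<dots> \<le> (1 + 3 * \<rho>) * ((1 + 3 * \<rho>) * ?w)"
    using harnack_ln_norm(2)[OF hol big, of w \<rho>] assms nonneg by (intro mult_left_mono *) auto
  also have "\<dots> = (1 + 6 * \<rho> + 9 * (\<rho> * \<rho>)) * ?w" by (simp add: algebra_simps)
  also have "\<dots> \<le> (1 + 9 * \<rho>) * ?w"
    using assms nonneg by (intro mult_right_mono) (auto simp: field_simps)
  finally show ?thesis .
qed

text \<open>A function omitting a ray has a single-valued argument confined to an interval of length
  \<open>2 pi\<close>. Its logarithm therefore maps into a strip, and a strip lies in a half-plane, so the
  half-plane Schwarz lemma bounds the oscillation of \<open>ln (norm g)\<close> by an absolute constant,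
  however large \<open>ln (norm g)\<close> itself is.\<close>

lemma ln_norm_oscillation_if_ray_omitted:
  assumes hol: "g holomorphic_on ball p r" and e: "e \<noteq> 0"
    and omit: "\<And>z t. z \<in> ball p r \<Longrightarrow> t \<ge> 0 \<Longrightarrow> g z \<noteq> of_real t * e"
    and z: "dist p z \<le> r / 2" and r: "r > 0"
  shows "\<bar>ln (norm (g z)) - ln (norm (g p))\<bar> \<le> 4 * pi"
proof -
  have slit: "- (g w / e) \<notin> \<real>\<^sub>\<le>\<^sub>0" if "w \<in> ball p r" for w
  proof
    assume "- (g w / e) \<in> \<real>\<^sub>\<le>\<^sub>0"
    then obtain t where t: "t \<le> 0" "- (g w / e) = of_real t"
      using nonpos_Reals_cases by blast
    then have "g w = of_real (-t) * e" using e by (simp add: field_simps) (metis minus_minus mult.commute)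
    with omit[OF that, of "-t"] t show False by simp
  qed
  define L where "L w = Ln (- (g w / e))" for w
  \<comment> \<open>The shift by \<open>2 * pi\<close> puts the strip, recentred at \<open>L p\<close> and rotated, into the right
    half-plane.\<close>
  define k where "k w = of_real (2 * pi) + \<i> * (L w - L p)" for w
  have p: "p \<in> ball p r" and zb: "z \<in> ball p r" using z r by auto
  have holL: "L holomorphic_on ball p r"
    unfolding L_def using slit e by (intro holomorphic_intros hol) auto
  have gnz: "g w \<noteq> 0" if "w \<in> ball p r" for w using omit[OF that, of 0] by simp
  have im: "\<bar>Im (L w)\<bar> < pi" if "w \<in> ball p r" for w
  proof -
    have nz: "- (g w / e) \<noteq> 0" using gnz[OF that] e by simp
    have "Im (L w) \<noteq> pi" using slit[OF that] nz unfolding L_def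
      by (metis Im_Ln_eq_pi complex_nonpos_Reals_iff less_imp_le)
    then show ?thesis
      using mpi_less_Im_Ln[OF nz] Im_Ln_le_pi[OF nz] by (auto simp: L_def)
  qed
  have re: "Re (L w) = ln (norm (g w)) - ln (norm e)" if "w \<in> ball p r" for w
    using gnz[OF that] e by (simp add: L_def norm_divide ln_div)
  have "k holomorphic_on ball p r" unfolding k_def by (intro holomorphic_intros holL)
  moreover have "Re (k w) > 0" if "w \<in> ball p r" for w
    using im[OF that] im[OF p] by (simp add: k_def)
  ultimately have "norm (k z - k p) \<le> dist p z / r * norm (k z + cnj (k p))"
    using zb by (intro schwarz_right_half_plane)
  also have "\<dots> \<le> 1/2 * norm (k z + cnj (k p))"
    by (rule mult_right_mono) (use z r in \<open>simp_all add: divide_le_eq\<close>)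
  also have "k z + cnj (k p) = (k z - k p) + of_real (4 * pi)" by (simp add: k_def)
  also have "norm \<dots> \<le> norm (k z - k p) + 4 * pi"
    by (rule order.trans[OF norm_triangle_ineq]) simp
  finally have "norm (k z - k p) \<le> 4 * pi" by simp
  moreover have "norm (k z - k p) = norm (L z - L p)" by (simp add: k_def norm_mult)
  moreover have "\<bar>Re (L z - L p)\<bar> \<le> norm (L z - L p)" by (rule abs_Re_le_cmod)
  ultimately show ?thesis using re[OF p] re[OF zb] by simp
qed

section \<open>Iterates on an escaping Fatou component\<close>

lemma open_fatou_set: "open (fatou_set f)"
  unfolding open_subopen[of "fatou_set f"]
proof
  fix z assume "z \<in> fatou_set f"
  then obtain D where "open D" "connected D" "z \<in> D" "normal_family_on {f ^^ n | n. n \<ge> 1} D"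
    unfolding fatou_set_def by blast
  then show "\<exists>T. open T \<and> z \<in> T \<and> T \<subseteq> fatou_set f"
    unfolding fatou_set_def by blast
qed

lemma holomorphic_iterate:
  assumes "f holomorphic_on UNIV"
  shows "(f ^^ n) holomorphic_on A"
proof -
  have "(f ^^ n) holomorphic_on UNIV"
  proof (induction n)
    case (Suc n)
    then show ?case using holomorphic_on_compose[of "f ^^ n" UNIV f] assms
      using holomorphic_on_subset by (metis funpow.simps(2) top_greatest)
  qed (simp add: id_def)
  then show ?thesis by (rule holomorphic_on_subset) simp
qed

lemma fatou_image_0:
  assumes "fatou_component f W"
  shows "fatou_image f W 0 = W"
  unfolding fatou_image_def
proof (rule the_equality)
  fix V assume V: "fatou_component f V \<and> (f ^^ 0) ` W \<subseteq> V"
  then have "W \<subseteq> V" by simp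
  moreover have "W \<noteq> {}" using assms by (auto simp: fatou_component_def dest: in_components_nonempty)
  ultimately show "V = W"
    using V assms components_eq[of V "fatou_set f" W] unfolding fatou_component_def by blast
qed (use assms in simp)

lemma fatou_component_normal_nbhd:
  assumes W: "fatou_component f W" and "z \<in> W"
  shows "\<exists>D. open D \<and> z \<in> D \<and> D \<subseteq> W \<and> normal_family_on {f ^^ n | n. n \<ge> 1} D"
proof -
  have comp: "W \<in> components (fatou_set f)" using W by (simp add: fatou_component_def)
  then have "z \<in> fatou_set f" using in_components_subset \<open>z \<in> W\<close> by blast
  then obtain D where D: "open D" "connected D" "z \<in> D" "normal_family_on {f ^^ n | n. n \<ge> 1} D"
    unfolding fatou_set_def by blast
  then have "D \<subseteq> fatou_set f" unfolding fatou_set_def by blast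
  then have "D \<subseteq> W" using components_maximal[OF comp D(2)] D(3) \<open>z \<in> W\<close> by blast
  with D show ?thesis by blast
qed

text \<open>Escape at a single point excludes finite limit functions, so by normality every
  subsequence of the iterates has a further subsequence tending to \<open>\<infinity>\<close> locally uniformly.\<close>

lemma escape_locally_uniform:
  assumes N: "normal_family_on {f ^^ n | n. n \<ge> 1} D" and "z \<in> D"
    and esc: "filterlim (\<lambda>n. (f ^^ n) z) at_infinity sequentially"
    and K: "compact K" "K \<subseteq> D"
  shows "\<forall>\<^sub>F n in sequentially. \<forall>w\<in>K. B < norm ((f ^^ n) w)"
proof (rule ccontr)
  assume "\<not> ?thesis"
  then obtain s :: "nat \<Rightarrow> nat"
    where s: "strict_mono s" "\<And>k. \<not> (\<forall>w\<in>K. B < norm ((f ^^ s k) w))"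
    using not_eventually_sequentiallyD by blast
  \<comment> \<open>The shift by one makes all exponents positive, as the family of iterates starts at \<open>1\<close>.\<close>
  define g where "g k = f ^^ s (Suc k)" for k
  have s_pos: "s (Suc k) \<ge> 1" for k
    using strict_mono_imp_increasing[OF s(1), of "Suc k"] by linarith
  then have "range g \<subseteq> {f ^^ n | n. n \<ge> 1}" by (auto simp: g_def)
  with N obtain r :: "nat \<Rightarrow> nat" where r: "strict_mono r"
    and alt: "(\<exists>h. h holomorphic_on D \<and> (\<forall>K. compact K \<and> K \<subseteq> D \<longrightarrow>
                    uniform_limit K (\<lambda>k. g (r k)) h sequentially)) \<or>
            (\<forall>K. compact K \<and> K \<subseteq> D \<longrightarrow>
                 (\<forall>B. \<forall>\<^sub>F k in sequentially. \<forall>z\<in>K. B < norm (g (r k) z)))"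
    unfolding normal_family_on_def by blast
  from alt show False
  proof
    assume "\<exists>h. h holomorphic_on D \<and> (\<forall>K. compact K \<and> K \<subseteq> D \<longrightarrow>
                    uniform_limit K (\<lambda>k. g (r k)) h sequentially)"
    then obtain h where "uniform_limit {z} (\<lambda>k. g (r k)) h sequentially"
      using \<open>z \<in> D\<close> by (metis compact_sing empty_subsetI insert_subset)
    then have lim: "(\<lambda>k. g (r k) z) \<longlonglongrightarrow> h z" by (rule tendsto_uniform_limitI) simp
    have "strict_mono (\<lambda>k. s (Suc (r k)))"
      using s(1) r by (auto simp: strict_mono_def)
    then have "filterlim (\<lambda>k. g (r k) z) at_infinity sequentially"
      unfolding g_def
      by (intro filterlim_compose[OF esc] filterlim_subseq)
    with lim show False
      using not_tendsto_and_filterlim_at_infinity trivial_limit_sequentially by blast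
  next
    assume "\<forall>K. compact K \<and> K \<subseteq> D \<longrightarrow> (\<forall>B. \<forall>\<^sub>F k in sequentially. \<forall>z\<in>K. B < norm (g (r k) z))"
    with K have "\<forall>\<^sub>F k in sequentially. \<forall>w\<in>K. B < norm (g (r k) w)" by blast
    then obtain k where "\<forall>w\<in>K. B < norm (g (r k) w)"
      using eventually_happens'[OF sequentially_bot] by blast
    with s(2)[of "Suc (r k)"] show False unfolding g_def by blast
  qed
qed

lemma escape_uniform_on_compact:
  assumes W: "fatou_component f W"
    and esc: "\<And>z. z \<in> W \<Longrightarrow> filterlim (\<lambda>n. (f ^^ n) z) at_infinity sequentially"
    and K: "compact K" "K \<subseteq> W"
  shows "\<forall>\<^sub>F n in sequentially. \<forall>w\<in>K. B < norm ((f ^^ n) w)"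
proof -
  have "\<exists>U. open U \<and> z \<in> U \<and> (\<forall>\<^sub>F n in sequentially. \<forall>w\<in>U. B < norm ((f ^^ n) w))" if z: "z \<in> W" for z
  proof -
    obtain D where D: "open D" "z \<in> D" "normal_family_on {f ^^ n | n. n \<ge> 1} D"
      using fatou_component_normal_nbhd[OF W z] by blast
    then obtain e where e: "e > 0" "cball z e \<subseteq> D" using open_contains_cball by blast
    have "\<forall>\<^sub>F n in sequentially. \<forall>w\<in>cball z e. B < norm ((f ^^ n) w)"
      by (rule escape_locally_uniform[OF D(3,2) esc[OF z] compact_cball e(2)])
    then have "\<forall>\<^sub>F n in sequentially. \<forall>w\<in>ball z e. B < norm ((f ^^ n) w)"
      by (rule eventually_mono) auto
    with e(1) show ?thesis by (intro exI[of _ "ball z e"]) auto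
  qed
  then have "\<forall>z\<in>W. \<exists>U. open U \<and> z \<in> U \<and> (\<forall>\<^sub>F n in sequentially. \<forall>w\<in>U. B < norm ((f ^^ n) w))"
    by blast
  then obtain U where U: "\<forall>z\<in>W. open (U z) \<and> z \<in> U z \<and>
      (\<forall>\<^sub>F n in sequentially. \<forall>w\<in>U z. B < norm ((f ^^ n) w))"
    by (rule bchoice[THEN exE])
  obtain F where F: "F \<subseteq> K" "finite F" "K \<subseteq> (\<Union>z\<in>F. U z)"
    by (rule compactE_image[OF K(1), of K U]) (use U K in blast)+
  have "\<forall>\<^sub>F n in sequentially. \<forall>z\<in>F. \<forall>w\<in>U z. B < norm ((f ^^ n) w)"
    using U F(1) K(2) by (intro eventually_ball_finite F(2)) blast
  then show ?thesis by (rule eventually_mono) (use F(3) in blast)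
qed

lemma normal_family_on_if_escape_uniform:
  assumes "f holomorphic_on UNIV"
    and esc: "\<And>B. \<forall>\<^sub>F n in sequentially. \<forall>w\<in>D. B < norm ((f ^^ n) w)"
  shows "normal_family_on {f ^^ n | n. n \<ge> 1} D"
  unfolding normal_family_on_def
proof (intro allI impI)
  fix g :: "nat \<Rightarrow> complex \<Rightarrow> complex"
  assume "range g \<subseteq> {f ^^ n | n. n \<ge> 1}"
  then have "\<forall>k. \<exists>n. g k = f ^^ n" by blast
  then obtain s where s: "\<And>k. g k = f ^^ s k" by metis
  show "\<exists>r :: nat \<Rightarrow> nat. strict_mono r \<and>
           ((\<exists>h. h holomorphic_on D \<and>
                 (\<forall>K. compact K \<and> K \<subseteq> D \<longrightarrow>
                    uniform_limit K (\<lambda>k. g (r k)) h sequentially)) \<or>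
            (\<forall>K. compact K \<and> K \<subseteq> D \<longrightarrow>
                 (\<forall>B. \<forall>\<^sub>F k in sequentially. \<forall>z\<in>K. B < norm (g (r k) z))))"
  \<comment> \<open>Either one iterate occurs infinitely often in the given sequence, which yields a constant
    subsequence, or the exponents tend to infinity.\<close>
  proof (cases "\<exists>m. infinite {k. s k = m}")
    case True
    then obtain m where "infinite {k. s k = m}" by blast
    then obtain r :: "nat \<Rightarrow> nat" where r: "strict_mono r" "\<And>k. r k \<in> {k. s k = m}"
      using infinite_enumerate by blast
    then have "g (r k) = f ^^ m" for k using s by simp
    then have "uniform_limit K (\<lambda>k. g (r k)) (f ^^ m) sequentially" for K
      by (auto intro!: uniform_limit_const)
    with r(1) holomorphic_iterate[OF assms(1)] show ?thesis by blast
  next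
    case False
    have s_lim: "filterlim s at_top sequentially"
      unfolding filterlim_at_top
    proof
      fix Z
      have "finite (\<Union>m\<in>{..<Z}. {k. s k = m})" using False by auto
      then have "finite {k. \<not> Z \<le> s k}" by (rule finite_subset[rotated]) auto
      then show "\<forall>\<^sub>F k in sequentially. Z \<le> s k"
        by (simp add: eventually_cofinite flip: cofinite_eq_sequentially)
    qed
    have "\<forall>\<^sub>F k in sequentially. \<forall>z\<in>K. B < norm (g (id k) z)" if "K \<subseteq> D" for K B
      using eventually_compose_filterlim[OF esc[of B] s_lim]
      by (rule eventually_mono) (use that s in auto)
    then show ?thesis by (intro exI[of _ id]) (auto simp: strict_mono_def)
  qed
qed

text \<open>If the iterates are eventually zero-free in \<open>\<Omega>\<close>, the minimum principle carries the uniform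
  escape from the frontier into \<open>\<Omega>\<close>. Then \<open>\<Omega>\<close> is in the Fatou set, and it meets \<open>W\<close> because
  its frontier lies in the open set \<open>W\<close>. Read contrapositively, infinitely many iterates have
  zeros in any region that is bounded by a curve in \<open>W\<close> and contains a point outside \<open>W\<close>.\<close>

lemma escaping_component_fills_bounded_open:
  assumes hol: "f holomorphic_on UNIV" and W: "fatou_component f W"
    and esc: "\<And>z. z \<in> W \<Longrightarrow> filterlim (\<lambda>n. (f ^^ n) z) at_infinity sequentially"
    and \<Omega>: "open \<Omega>" "connected \<Omega>" "bounded \<Omega>" "frontier \<Omega> \<subseteq> W" "\<Omega> \<noteq> {}"
    and nz: "\<forall>\<^sub>F n in sequentially. \<forall>z\<in>\<Omega>. (f ^^ n) z \<noteq> 0"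
  shows "\<Omega> \<subseteq> W"
proof -
  have comp: "W \<in> components (fatou_set f)" using W by (simp add: fatou_component_def)
  have "\<forall>\<^sub>F n in sequentially. \<forall>w\<in>\<Omega>. B < norm ((f ^^ n) w)" for B
  proof -
    have "\<forall>\<^sub>F n in sequentially. \<forall>w\<in>frontier \<Omega>. max 1 (B + 1) < norm ((f ^^ n) w)"
      by (rule escape_uniform_on_compact[OF W esc _ \<Omega>(4)]) (use \<Omega>(3) in \<open>auto simp: compact_frontier_bounded\<close>)
    with nz show ?thesis
    proof eventually_elim
      case (elim n)
      let ?g = "f ^^ n"
      have nzc: "?g z \<noteq> 0" if "z \<in> closure \<Omega>" for z
      proof (cases "z \<in> \<Omega>")
        case False
        with that \<Omega>(1) have "z \<in> frontier \<Omega>" by (simp add: frontier_def interior_open)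
        with elim(2) have "1 < norm (?g z)" by fastforce
        then show ?thesis by auto
      qed (use elim(1) in blast)
      have inv: "(\<lambda>z. inverse (?g z)) holomorphic_on \<Omega>"
        using elim(1) by (intro holomorphic_intros holomorphic_iterate[OF hol]) auto
      have cont: "continuous_on (closure \<Omega>) (\<lambda>z. inverse (?g z))"
        using nzc by (intro continuous_intros holomorphic_on_imp_continuous_on holomorphic_iterate[OF hol]) auto
      show ?case
      proof
        fix w assume w: "w \<in> \<Omega>"
        have "norm (inverse (?g w)) \<le> inverse (max 1 (B + 1))"
        proof (rule maximum_modulus_frontier[OF _ cont \<Omega>(3) _ w])
          show "(\<lambda>z. inverse (?g z)) holomorphic_on interior \<Omega>"
            using inv \<Omega>(1) by (simp add: interior_open)
          fix z assume "z \<in> frontier \<Omega>"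
          with elim(2) have "max 1 (B + 1) < norm (?g z)" by blast
          then show "norm (inverse (?g z)) \<le> inverse (max 1 (B + 1))"
            unfolding norm_inverse by (intro le_imp_inverse_le) auto
        qed
        then have "max 1 (B + 1) \<le> norm (?g w)"
          using elim(1) w by (simp add: norm_inverse inverse_le_iff_le)
        then show "B < norm (?g w)" by linarith
      qed
    qed
  qed
  then have "normal_family_on {f ^^ n | n. n \<ge> 1} \<Omega>"
    by (rule normal_family_on_if_escape_uniform[OF hol])
  then have sub: "\<Omega> \<subseteq> fatou_set f" using \<Omega>(1,2) unfolding fatou_set_def by blast
  have "frontier \<Omega> \<noteq> {}" using \<Omega> frontier_eq_empty not_bounded_UNIV by metis
  then obtain x where x: "x \<in> frontier \<Omega>" by blast
  have "open W" using comp open_fatou_set open_components by blast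
  moreover have "x \<in> W" "x \<in> closure \<Omega>" using x \<Omega>(4) by (auto simp: frontier_def)
  ultimately have "W \<inter> \<Omega> \<noteq> {}" using open_Int_closure_eq_empty[of W \<Omega>] by blast
  then show ?thesis using components_maximal[OF comp \<Omega>(2) sub] by blast
qed

text \<open>The image of \<open>\<Omega>\<close> is a bounded open set containing \<open>0\<close>, so every ray from \<open>0\<close> leaves it
  through its frontier, which comes from the frontier of \<open>\<Omega>\<close>.\<close>

lemma holomorphic_image_frontier_hits_ray:
  assumes hol: "g holomorphic_on UNIV"
    and \<Omega>: "open \<Omega>" "connected \<Omega>" "bounded \<Omega>"
    and zero: "z \<in> \<Omega>" "g z = 0" and nz: "\<And>w. w \<in> frontier \<Omega> \<Longrightarrow> g w \<noteq> 0" and e: "e \<noteq> 0"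
  shows "\<exists>w\<in>frontier \<Omega>. \<exists>t>0. g w = of_real t * e"
proof -
  have cont: "continuous_on A g" for A
    using hol holomorphic_on_imp_continuous_on continuous_on_subset by blast
  have "frontier \<Omega> \<noteq> {}"
    unfolding frontier_eq_empty using \<Omega>(3) zero(1) not_bounded_UNIV by auto
  then obtain x where x: "x \<in> frontier \<Omega>" by blast
  have nonconst: "\<not> g constant_on \<Omega>"
  proof
    assume "g constant_on \<Omega>"
    then obtain c where c: "\<And>w. w \<in> \<Omega> \<Longrightarrow> g w = c" unfolding constant_on_def by blast
    have "x \<in> closure \<Omega>" using x by (simp add: frontier_def)
    then have "g x = c" using continuous_constant_on_closure[OF cont c] by blast
    moreover have "c = 0" using c[OF zero(1)] zero(2) by simp
    ultimately have "g x = 0" by simp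
    with nz x show False by blast
  qed
  have op: "open (g ` \<Omega>)"
    by (rule open_mapping_thm[OF holomorphic_on_subset[OF hol] \<Omega>(1,2) \<Omega>(1) _ nonconst]) auto
  have cpt: "compact (g ` closure \<Omega>)"
    using \<Omega>(3) cont by (intro compact_continuous_image) auto
  have bd: "bounded (g ` \<Omega>)"
    by (rule bounded_subset[OF compact_imp_bounded[OF cpt]]) (use closure_subset in blast)
  have fr: "frontier (g ` \<Omega>) \<subseteq> g ` frontier \<Omega>"
  proof -
    have "closure (g ` \<Omega>) \<subseteq> g ` closure \<Omega>"
      by (rule closure_minimal) (use closure_subset compact_imp_closed[OF cpt] in blast)+
    then show ?thesis using op \<Omega>(1) by (auto simp: frontier_def interior_open)
  qed
  define R where "R = (\<lambda>t. of_real t * e) ` {0..}"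
  have "connected R" unfolding R_def
    by (intro connected_continuous_image continuous_intros) (simp add: convex_connected)
  moreover have "R \<inter> g ` \<Omega> \<noteq> {}"
  proof -
    have "0 \<in> R" unfolding R_def by force
    moreover have "0 \<in> g ` \<Omega>" using zero by force
    ultimately show ?thesis by blast
  qed
  moreover have "R - g ` \<Omega> \<noteq> {}"
  proof -
    obtain b where b: "b > 0" "\<And>y. y \<in> g ` \<Omega> \<Longrightarrow> norm y \<le> b" using bd bounded_pos by metis
    let ?y = "of_real ((b + 1) / norm e) * e"
    have "norm ?y = b + 1" using b e by (simp add: norm_mult norm_divide)
    with b(2)[of ?y] have "?y \<notin> g ` \<Omega>" by auto
    moreover have "?y \<in> R" unfolding R_def using b e by (intro imageI) simp
    ultimately show ?thesis by blast
  qed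
  ultimately have "R \<inter> frontier (g ` \<Omega>) \<noteq> {}" by (rule connected_Int_frontier)
  then obtain y where "y \<in> R" "y \<in> g ` frontier \<Omega>" using fr by blast
  then obtain t w where tw: "t \<ge> 0" "w \<in> frontier \<Omega>" "g w = of_real t * e"
    unfolding R_def by auto
  have "t \<noteq> 0" using nz[OF tw(2)] tw(3) by auto
  with tw show ?thesis by (intro bexI[of _ w] exI[of _ t]) auto
qed

text \<open>A loop in \<open>W\<close> with nonzero winding number about a point \<open>z\<close> outside \<open>W\<close> exists by the
  winding-number characterisation of simple connectivity; \<open>\<Omega>\<close> is the component of the complement
  of the loop that contains \<open>z\<close>.\<close>

lemma multiply_connected_surrounded_point:
  assumes "open W" "multiply_connected W"
  obtains \<gamma> \<Omega> where "path \<gamma>" "path_image \<gamma> \<subseteq> W" "open \<Omega>" "connected \<Omega>" "bounded \<Omega>" 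
     "frontier \<Omega> \<subseteq> path_image \<gamma>" "\<not> \<Omega> \<subseteq> W"
proof -
  obtain \<gamma> z where \<gamma>: "path \<gamma>" "path_image \<gamma> \<subseteq> W" "pathfinish \<gamma> = pathstart \<gamma>" 
     "z \<notin> W" "winding_number \<gamma> z \<noteq> 0"
    using assms simply_connected_eq_winding_number_zero[OF assms(1)]
    unfolding multiply_connected_def by blast
  let ?\<Omega> = "connected_component_set (- path_image \<gamma>) z"
  have z: "z \<in> - path_image \<gamma>" using \<gamma> by blast
  have op: "open (- path_image \<gamma>)" using \<gamma>(1) by (simp add: closed_path_image open_Compl)
  have "z \<in> inside (path_image \<gamma>)"
    using winding_number_zero_in_outside[OF \<gamma>(1,3)] \<gamma>(5) z inside_Un_outside[of "path_image \<gamma>"]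
    by blast
  then have bd: "bounded ?\<Omega>" by (simp add: inside_def)
  have "frontier ?\<Omega> \<subseteq> frontier (- path_image \<gamma>)"
    by (rule frontier_of_connected_component_subset)
  also have "\<dots> \<subseteq> path_image \<gamma>"
    using closed_path_image[OF \<gamma>(1)] by (simp add: frontier_complement frontier_subset_eq)
  finally have fr: "frontier ?\<Omega> \<subseteq> path_image \<gamma>" .
  have "z \<in> ?\<Omega>" using z by (simp add: connected_component_refl)
  then have "\<not> ?\<Omega> \<subseteq> W" using \<gamma>(4) by blast
  then show ?thesis
    by (rule that[OF \<gamma>(1,2) open_connected_component[OF op] connected_connected_component bd fr])
qed

section \<open>Exponential sums on rays\<close>

lemma poly_bound_on_ray:
  fixes p :: "complex poly"
  assumes "norm e = 1"
  shows "\<exists>A>0. \<forall>t\<ge>1. norm (poly p (of_real t * e)) \<le> A * t ^ degree p"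
proof (intro exI conjI allI impI)
  let ?A = "(\<Sum>i\<le>degree p. norm (coeff p i)) + 1"
  show "?A > 0" by (rule add_nonneg_pos) (auto intro: sum_nonneg)
  fix t :: real assume t: "t \<ge> 1"
  have "norm (poly p (of_real t * e)) \<le> (\<Sum>i\<le>degree p. norm (coeff p i * (of_real t * e) ^ i))"
    unfolding poly_altdef by (rule norm_sum)
  also have "\<dots> = (\<Sum>i\<le>degree p. norm (coeff p i) * t ^ i)"
    using t assms by (simp add: norm_mult norm_power)
  also have "\<dots> \<le> (\<Sum>i\<le>degree p. norm (coeff p i) * t ^ degree p)"
    using t by (intro sum_mono mult_left_mono power_increasing) auto
  also have "\<dots> \<le> ?A * t ^ degree p" using t by (simp add: sum_distrib_right distrib_right)
  finally show "norm (poly p (of_real t * e)) \<le> ?A * t ^ degree p" .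
qed

text \<open>The exponent \<open>d - 1/2\<close> separates the leading order \<open>d\<close> from all lower degrees.\<close>

lemma poly_small_on_ray:
  fixes q :: "complex poly"
  assumes e: "norm e = 1" and "degree q < d" and "\<eta> > 0"
  shows "\<forall>\<^sub>F t in at_top. norm (poly q (of_real t * e)) \<le> \<eta> * t powr (real d - 1/2)"
proof -
  obtain A where A: "A > 0" "\<And>t. t \<ge> 1 \<Longrightarrow> norm (poly q (of_real t * e)) \<le> A * t ^ degree q"
    using poly_bound_on_ray[OF e] by blast
  have "\<forall>\<^sub>F t in at_top. A \<le> \<eta> * t powr (1/2)" using A(1) \<open>\<eta> > 0\<close> by real_asymp
  with eventually_ge_at_top[of "1::real"] show ?thesis
  proof eventually_elim
    case (elim t)
    have "norm (poly q (of_real t * e)) \<le> A * t ^ degree q" using A(2) elim by blast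
    also have "\<dots> \<le> A * t ^ (d - 1)"
      using A(1) elim assms by (intro mult_left_mono power_increasing) auto
    also have "\<dots> = A * t powr (real d - 1)"
      using elim assms by (simp add: powr_realpow[symmetric] of_nat_diff)
    also have "\<dots> \<le> \<eta> * t powr (1/2) * t powr (real d - 1)"
      using elim by (intro mult_right_mono) auto
    also have "\<dots> = \<eta> * t powr (real d - 1/2)"
      by (simp add: mult.assoc flip: powr_add)
    finally show ?case .
  qed
qed

lemma poly_subexponential_on_ray:
  fixes p :: "complex poly"
  assumes e: "norm e = 1" and "d > 0" and "\<eta> > 0"
  shows "\<forall>\<^sub>F t in at_top. norm (poly p (of_real t * e)) \<le> exp (\<eta> * t powr (real d - 1/2))"
proof -
  obtain A where A: "A > 0" "\<And>t. t \<ge> 1 \<Longrightarrow> norm (poly p (of_real t * e)) \<le> A * t ^ degree p"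
    using poly_bound_on_ray[OF e] by blast
  have "\<forall>\<^sub>F t in at_top. A * t powr (real (degree p)) \<le> exp (\<eta> * t powr (1/2))"
    using A(1) \<open>\<eta> > 0\<close> by real_asymp
  with eventually_ge_at_top[of "1::real"] show ?thesis
  proof eventually_elim
    case (elim t)
    have "norm (poly p (of_real t * e)) \<le> A * t powr (real (degree p))"
      using A(2)[OF elim(1)] elim by (simp add: powr_realpow)
    also note elim(2)
    also have "exp (\<eta> * t powr (1/2)) \<le> exp (\<eta> * t powr (real d - 1/2))"
      using elim assms by (intro iffD2[OF exp_le_cancel_iff] mult_left_mono powr_mono) auto
    finally show ?case .
  qed
qed

lemma exp_term_small_on_ray:
  fixes p q :: "complex poly"
  assumes e: "norm e = 1" and "d > 0"
    and re: "\<forall>\<^sub>F t in at_top. Re (poly q (of_real t * e)) \<le> 1/4 * t powr (real d - 1/2)"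
  shows "\<forall>\<^sub>F t in at_top. norm (poly p (of_real t * e) * exp (poly q (of_real t * e)))
           \<le> exp (1/2 * t powr (real d - 1/2))"
  using re poly_subexponential_on_ray[OF e \<open>d > 0\<close>, of "1/4" p, simplified]
proof eventually_elim
  case (elim t)
  have "norm (poly p (of_real t * e) * exp (poly q (of_real t * e)))
      \<le> exp (1/4 * t powr (real d - 1/2)) * exp (1/4 * t powr (real d - 1/2))"
    unfolding norm_mult norm_exp_eq_Re using elim by (intro mult_mono) auto
  also have "\<dots> = exp (1/2 * t powr (real d - 1/2))" by (simp flip: exp_add)
  finally show ?case .
qed

lemma exp_sum_small_on_ray:
  fixes P Q :: "nat \<Rightarrow> complex poly"
  assumes I: "finite I" and e: "norm e = 1" and "d > 0"
    and re: "\<And>i. i \<in> I \<Longrightarrow> \<forall>\<^sub>F t in at_top. Re (poly (Q i) (of_real t * e)) \<le> 1/4 * t powr (real d - 1/2)"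
  shows "\<forall>\<^sub>F t in at_top. norm ((\<Sum>i\<in>I. poly (P i) (of_real t * e) * exp (poly (Q i) (of_real t * e))) + poly R (of_real t * e))
           \<le> exp (t powr (real d - 1/2))"
proof -
  have 1: "\<forall>\<^sub>F t in at_top. \<forall>i\<in>I. norm (poly (P i) (of_real t * e) * exp (poly (Q i) (of_real t * e)))
           \<le> exp (1/2 * t powr (real d - 1/2))"
    using I exp_term_small_on_ray[OF e \<open>d > 0\<close> re] by (intro eventually_ball_finite) auto
  have 2: "\<forall>\<^sub>F t in at_top. norm (poly R (of_real t * e)) \<le> exp (1/2 * t powr (real d - 1/2))"
    by (rule poly_subexponential_on_ray[OF e \<open>d > 0\<close>]) simp
  have d: "real d - 1/2 > 0" using \<open>d > 0\<close> by linarith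
  have "\<forall>\<^sub>F s in at_top. real (card I + 1) * exp (1/2 * s) \<le> exp s" by real_asymp
  moreover have "filterlim (\<lambda>t::real. t powr (real d - 1/2)) at_top at_top"
    using d by real_asymp
  ultimately have 3: "\<forall>\<^sub>F t in at_top. real (card I + 1) * exp (1/2 * t powr (real d - 1/2)) \<le> exp (t powr (real d - 1/2))"
    by (rule eventually_compose_filterlim)
  from 1 2 3 show ?thesis
  proof eventually_elim
    case (elim t)
    let ?E = "exp (1/2 * t powr (real d - 1/2))"
    have "norm ((\<Sum>i\<in>I. poly (P i) (of_real t * e) * exp (poly (Q i) (of_real t * e))) + poly R (of_real t * e))
      \<le> (\<Sum>i\<in>I. ?E) + ?E"
      using elim(1,2) by (intro norm_triangle_mono sum_norm_le) auto
    also have "\<dots> = real (card I + 1) * ?E" by (simp add: algebra_simps)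
    finally show ?case using elim(3) by simp
  qed
qed

lemma poly_norm_lower_bound_on_ray:
  fixes p :: "complex poly"
  assumes "p \<noteq> 0" and e: "norm e = 1"
  obtains \<delta> where "\<delta> > 0" "\<forall>\<^sub>F t in at_top. norm (poly p (of_real t * e)) \<ge> \<delta>"
proof (cases "degree p = 0")
  case True
  then obtain a where a: "p = [:a:]" by (rule degree_eq_zeroE)
  with assms have "a \<noteq> 0" by auto
  with a show ?thesis by (intro that[of "norm a"]) auto
next
  case False
  have lim: "filterlim (\<lambda>t. of_real t * e) at_infinity at_top"
    unfolding filterlim_at_infinity_conv_norm_at_top
    using e by (simp add: norm_mult filterlim_abs_real)
  have "filterlim (poly p) at_infinity at_infinity"
    using False by (intro filterlim_poly_at_infinity) auto
  from filterlim_compose[OF this lim]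
  have "filterlim (\<lambda>t. norm (poly p (of_real t * e))) at_top at_top"
    by (simp add: filterlim_at_infinity_conv_norm_at_top)
  then show ?thesis by (intro that[of 1]) (auto simp: filterlim_at_top)
qed

text \<open>On a ray where \<open>lead_coeff q * e ^ d\<close> is real, the leading monomial contributes exactly
  \<open>a * t ^ d\<close>, and the lower-order terms are negligible against \<open>t powr (d - 1/2)\<close>.\<close>

lemma leading_term_on_ray:
  fixes q :: "complex poly"
  assumes e: "norm e = 1" and d: "degree q = d" "d > 0" and "\<eta> > 0"
    and a: "lead_coeff q * e ^ d = of_real a"
  shows "\<forall>\<^sub>F t in at_top. \<bar>Re (poly q (of_real t * e)) - a * t ^ d\<bar> \<le> \<eta> * t powr (real d - 1/2)"
proof -
  let ?q = "q - monom (lead_coeff q) d"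
  have "?q = 0 \<or> degree ?q < d"
    by (rule eq_zero_or_degree_less) (use d in \<open>auto intro: degree_diff_le degree_monom_le\<close>)
  with \<open>d > 0\<close> have "degree ?q < d" by auto
  from poly_small_on_ray[OF e this \<open>\<eta> > 0\<close>] show ?thesis
  proof eventually_elim
    case (elim t)
    have "poly ?q (of_real t * e) = poly q (of_real t * e) - of_real t ^ d * (lead_coeff q * e ^ d)"
      by (simp add: poly_monom power_mult_distrib)
    also have "\<dots> = poly q (of_real t * e) - of_real (a * t ^ d)" 
      unfolding a by simp
    finally have "Re (poly q (of_real t * e)) - a * t ^ d = Re (poly ?q (of_real t * e))" by simp
    then show ?case using order.trans[OF abs_Re_le_cmod elim] by (simp only:)
  qed
qed

text \<open>In a direction where the leading term of \<open>Q m\<close> is positive, the summand of index \<open>m\<close> grows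
  like the exponential of \<open>a * t ^ d\<close>, while all others have exponents of strictly smaller degree.\<close>

lemma exp_sum_large_on_ray:
  fixes P Q :: "nat \<Rightarrow> complex poly"
  assumes I: "finite I" "m \<in> I" and e: "norm e = 1" and d: "degree (Q m) = d" "d > 0"
    and P: "P m \<noteq> 0" and less: "\<And>i. i \<in> I - {m} \<Longrightarrow> degree (Q i) < d"
    and a: "lead_coeff (Q m) * e ^ d = of_real a" "a > 0"
  shows "\<forall>\<^sub>F t in at_top. exp (a / 2 * t ^ d)
    \<le> norm ((\<Sum>i\<in>I. poly (P i) (of_real t * e) * exp (poly (Q i) (of_real t * e))) + poly R (of_real t * e))"
proof -
  have 1: "\<forall>\<^sub>F t in at_top. norm ((\<Sum>i\<in>I-{m}. poly (P i) (of_real t * e) * exp (poly (Q i) (of_real t * e))) + poly R (of_real t * e))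
           \<le> exp (t powr (real d - 1/2))"
  proof (rule exp_sum_small_on_ray)
    fix i assume "i \<in> I - {m}"
    from poly_small_on_ray[OF e less[OF this], of "1/4"]
    have "\<forall>\<^sub>F t in at_top. norm (poly (Q i) (of_real t * e)) \<le> 1/4 * t powr (real d - 1/2)" by simp
    then show "\<forall>\<^sub>F t in at_top. Re (poly (Q i) (of_real t * e)) \<le> 1/4 * t powr (real d - 1/2)"
      by (rule eventually_mono) (use complex_Re_le_cmod in \<open>blast intro: order_trans\<close>)
  qed (use I e d in auto)
  obtain \<delta> where \<delta>: "\<delta> > 0" "\<forall>\<^sub>F t in at_top. norm (poly (P m) (of_real t * e)) \<ge> \<delta>"
    using poly_norm_lower_bound_on_ray[OF P e] .
  have 3: "\<forall>\<^sub>F t in at_top. \<bar>Re (poly (Q m) (of_real t * e)) - a * t ^ d\<bar> \<le> 1 * t powr (real d - 1/2)"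
    by (rule leading_term_on_ray[OF e d _ a(1)]) simp
  have "\<forall>\<^sub>F t in at_top. 1 \<le> a / 8 * t powr (1/2)" using a(2) by real_asymp
  with eventually_ge_at_top[of "1::real"]
  have 4: "\<forall>\<^sub>F t in at_top. t powr (real d - 1/2) \<le> a / 8 * t ^ d"
  proof eventually_elim
    case (elim t)
    have "1 * t powr (real d - 1/2) \<le> a / 8 * t powr (1/2) * t powr (real d - 1/2)"
      using elim by (intro mult_right_mono) auto
    also have "\<dots> = a / 8 * t ^ d" using elim by (simp add: mult.assoc powr_realpow flip: powr_add)
    finally show ?case by simp
  qed
  \<comment> \<open>The dominant exponent is at least \<open>a - a/8\<close> times \<open>t ^ d\<close> and the others are at most \<open>a/8\<close>
    times it, which leaves room for the claimed \<open>a/2\<close>.\<close>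
  have "\<forall>\<^sub>F s in at_top. exp (a / 2 * s) + exp (a / 8 * s) \<le> \<delta> * exp (7 / 8 * a * s)"
    using a(2) \<delta>(1) by real_asymp
  moreover have "filterlim (\<lambda>t::real. t ^ d) at_top at_top"
    using \<open>d > 0\<close> by (intro filterlim_pow_at_top filterlim_ident)
  ultimately have 5: "\<forall>\<^sub>F t in at_top. exp (a / 2 * t ^ d) + exp (a / 8 * t ^ d) \<le> \<delta> * exp (7 / 8 * a * t ^ d)"
    by (rule eventually_compose_filterlim)
  from 1 \<delta>(2) 3 4 5 show ?thesis
  proof eventually_elim
    case (elim t)
    let ?z = "of_real t * e"
    let ?M = "poly (P m) ?z * exp (poly (Q m) ?z)"
    let ?S = "(\<Sum>i\<in>I-{m}. poly (P i) ?z * exp (poly (Q i) ?z)) + poly R ?z"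
    have "\<delta> * exp (7 / 8 * a * t ^ d) \<le> norm ?M"
      unfolding norm_mult norm_exp_eq_Re using elim \<delta>(1) by (intro mult_mono) auto
    moreover have "norm ?S \<le> exp (a / 8 * t ^ d)"
      by (rule order.trans[OF elim(1)]) (use elim(4) in simp)
    moreover have "norm ?M - norm ?S \<le> norm (?M + ?S)" by (rule norm_diff_ineq)
    ultimately have "exp (a / 2 * t ^ d) \<le> norm (?M + ?S)" using elim(5) by linarith
    then show ?case by (simp only: sum.remove[OF I] add.assoc)
  qed
qed

text \<open>In a direction where the leading term of \<open>Q m\<close> is negative, the dominant summand dies out
  and what remains has lower order, although the remaining summands may well be large.\<close>

lemma exp_sum_small_on_decay_ray:
  fixes P Q :: "nat \<Rightarrow> complex poly"
  assumes I: "finite I" "m \<in> I" and e: "norm e = 1" and d: "degree (Q m) = d" "d > 0"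
    and less: "\<And>i. i \<in> I - {m} \<Longrightarrow> degree (Q i) < d"
    and a: "lead_coeff (Q m) * e ^ d = of_real a" "a < 0"
  shows "\<forall>\<^sub>F t in at_top.
    norm ((\<Sum>i\<in>I. poly (P i) (of_real t * e) * exp (poly (Q i) (of_real t * e))) + poly R (of_real t * e))
    \<le> exp (t powr (real d - 1/2))"
proof (rule exp_sum_small_on_ray[OF I(1) e d(2)])
  fix i assume i: "i \<in> I"
  show "\<forall>\<^sub>F t in at_top. Re (poly (Q i) (of_real t * e)) \<le> 1/4 * t powr (real d - 1/2)"
  proof (cases "i = m")
    case True
    have "\<forall>\<^sub>F t in at_top. \<bar>Re (poly (Q m) (of_real t * e)) - a * t ^ d\<bar> \<le> 1/4 * t powr (real d - 1/2)"
      by (rule leading_term_on_ray[OF e d _ a(1)]) simp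
    with eventually_ge_at_top[of "0::real"] show ?thesis
    proof eventually_elim
      case (elim t)
      have "a * t ^ d \<le> 0" using elim(1) a(2) by (intro mult_nonpos_nonneg) auto
      then show ?case unfolding True using elim(2) by linarith
    qed
  next
    case False
    with i have "degree (Q i) < d" using less by blast
    from poly_small_on_ray[OF e this, of "1/4"]
    have "\<forall>\<^sub>F t in at_top. norm (poly (Q i) (of_real t * e)) \<le> 1/4 * t powr (real d - 1/2)" by simp
    then show ?thesis
      by (rule eventually_mono) (use complex_Re_le_cmod in \<open>blast intro: order_trans\<close>)
  qed
qed

lemma unit_direction_of_leading_coeff:
  fixes c u :: complex
  assumes "d > 0" "c \<noteq> 0" "norm u = 1"
  shows "\<exists>e. norm e = 1 \<and> c * e ^ d = of_real (norm c) * u"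
proof -
  obtain e where e: "u * of_real (norm c) / c = e ^ d"
    by (rule exists_complex_root[of d]) (use \<open>d > 0\<close> in simp)
  have "norm e ^ d = norm (e ^ d)" by (simp only: norm_power)
  also have "\<dots> = 1" unfolding e[symmetric] using assms(2,3) by (simp add: norm_mult norm_divide)
  finally have "norm e = 1" using power_eq_imp_eq_base[of "norm e" d 1] \<open>d > 0\<close> by simp
  moreover have "c * e ^ d = of_real (norm c) * u" unfolding e[symmetric] using assms(2) by simp
  ultimately show ?thesis by blast
qed

section \<open>Comparison along a loop\<close>

lemma chain_bound:
  fixes \<phi> :: "real \<Rightarrow> real"
  assumes step: "\<And>s t. s \<in> {0..1} \<Longrightarrow> t \<in> {0..1} \<Longrightarrow> \<bar>s - t\<bar> \<le> 1 / real N \<Longrightarrow> \<bar>\<phi> s - \<phi> t\<bar> \<le> A"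
    and "N > 0" "s \<in> {0..1}" "t \<in> {0..1}"
  shows "\<bar>\<phi> s - \<phi> t\<bar> \<le> real N * A"
proof -
  define x where "x i = s + (t - s) * (real i / real N)" for i
  have x01: "x i \<in> {0..1}" if "i \<le> N" for i
  proof -
    have "x i = (1 - real i / real N) * s + (real i / real N) * t"
      by (simp add: x_def diff_divide_distrib algebra_simps)
    moreover have "real i / real N \<in> {0..1}" using that \<open>N > 0\<close> by simp
    ultimately show ?thesis
      using convexD_alt[of "{0..1::real}" s t "real i / real N"] assms by simp
  qed
  have "\<bar>\<phi> (x i) - \<phi> s\<bar> \<le> real i * A" if "i \<le> N" for i
    using that
  proof (induction i)
    case (Suc i)
    have "\<bar>x (Suc i) - x i\<bar> = \<bar>t - s\<bar> / real N" 
    proof -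
      have "x (Suc i) - x i = (t - s) / real N"
        by (simp add: x_def add_divide_distrib distrib_left)
      then show ?thesis by simp
    qed
    also have "\<dots> \<le> 1 / real N" using assms by (intro divide_right_mono) auto
    finally have "\<bar>\<phi> (x (Suc i)) - \<phi> (x i)\<bar> \<le> A" using step x01 Suc by auto
    then show ?case using Suc by (auto simp: algebra_simps)
  qed (simp add: x_def)
  from this[of N] have "\<bar>\<phi> (x N) - \<phi> s\<bar> \<le> real N * A" by simp
  moreover have "x N = t" using \<open>N > 0\<close> by (simp add: x_def)
  ultimately show ?thesis by simp
qed

text \<open>The number \<open>N\<close> depends on the path and on \<open>r\<close> only. That the same \<open>N\<close> serves all functions
  \<open>\<phi>\<close> makes the estimates below uniform over the iterates.\<close>

lemma bounded_variation_along_path: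
  assumes "path \<gamma>" "r > 0"
  obtains N :: nat where "N > 0"
    "\<And>\<phi> :: complex \<Rightarrow> real. \<And>A z w.
       (\<And>p q. p \<in> path_image \<gamma> \<Longrightarrow> q \<in> path_image \<gamma> \<Longrightarrow> dist p q \<le> r \<Longrightarrow> \<bar>\<phi> q - \<phi> p\<bar> \<le> A)
       \<Longrightarrow> z \<in> path_image \<gamma> \<Longrightarrow> w \<in> path_image \<gamma> \<Longrightarrow> \<bar>\<phi> z - \<phi> w\<bar> \<le> real N * A"
proof -
  have "uniformly_continuous_on {0..1} \<gamma>"
    using assms(1) by (simp add: path_def compact_uniformly_continuous)
  then obtain \<delta> where \<delta>: "\<delta> > 0"
      "\<And>s t. s \<in> {0..1} \<Longrightarrow> t \<in> {0..1} \<Longrightarrow> dist s t < \<delta> \<Longrightarrow> dist (\<gamma> s) (\<gamma> t) < r"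
    using \<open>r > 0\<close> unfolding uniformly_continuous_on_def by meson
  obtain N :: nat where N: "N > 0" "1 / real N < \<delta>"
    using nat_approx_posE[OF \<delta>(1)] by (metis zero_less_Suc)
  show ?thesis
  proof (rule that[OF N(1)])
    fix \<phi> :: "complex \<Rightarrow> real" and A z w
    assume step: "\<And>p q. p \<in> path_image \<gamma> \<Longrightarrow> q \<in> path_image \<gamma> \<Longrightarrow> dist p q \<le> r \<Longrightarrow> \<bar>\<phi> q - \<phi> p\<bar> \<le> A"
    assume "z \<in> path_image \<gamma>" "w \<in> path_image \<gamma>"
    then obtain s t where st: "s \<in> {0..1}" "t \<in> {0..1}" "z = \<gamma> s" "w = \<gamma> t"
      unfolding path_image_def by blast
    have "\<bar>\<phi> (\<gamma> s) - \<phi> (\<gamma> t)\<bar> \<le> real N * A"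
    proof (rule chain_bound[where \<phi> = "\<lambda>x. \<phi> (\<gamma> x)", OF _ N(1) st(1,2)])
      fix x y :: real assume xy: "x \<in> {0..1}" "y \<in> {0..1}" "\<bar>x - y\<bar> \<le> 1 / real N"
      then have "dist y x < \<delta>" using N(2) by (simp add: dist_real_def abs_minus_commute)
      then have "dist (\<gamma> y) (\<gamma> x) \<le> r" using \<delta>(2) xy(1,2) less_imp_le by blast
      then show "\<bar>\<phi> (\<gamma> x) - \<phi> (\<gamma> y)\<bar> \<le> A" using xy(1,2) by (intro step) (auto simp: path_image_def)
    qed
    then show "\<bar>\<phi> z - \<phi> w\<bar> \<le> real N * A" by (simp add: st)
  qed
qed

text \<open>Harnack's inequality is additive for \<open>ln (ln (norm g))\<close>, so the local bounds add up along the
  path.\<close>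

lemma harnack_along_path:
  assumes "path \<gamma>" "r > 0"
  obtains C :: real where "C \<ge> 1"
    "\<And>g z w. g holomorphic_on UNIV \<Longrightarrow> (\<And>p x. p \<in> path_image \<gamma> \<Longrightarrow> x \<in> ball p r \<Longrightarrow> norm (g x) > 1)
       \<Longrightarrow> z \<in> path_image \<gamma> \<Longrightarrow> w \<in> path_image \<gamma> \<Longrightarrow> ln (norm (g z)) \<le> C * ln (norm (g w))"
proof -
  have "r / 3 > 0" using \<open>r > 0\<close> by simp
  obtain N :: nat where N: "N > 0"
    "\<And>\<phi> :: complex \<Rightarrow> real. \<And>A z w.
       (\<And>p q. p \<in> path_image \<gamma> \<Longrightarrow> q \<in> path_image \<gamma> \<Longrightarrow> dist p q \<le> r / 3 \<Longrightarrow> \<bar>\<phi> q - \<phi> p\<bar> \<le> A)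
       \<Longrightarrow> z \<in> path_image \<gamma> \<Longrightarrow> w \<in> path_image \<gamma> \<Longrightarrow> \<bar>\<phi> z - \<phi> w\<bar> \<le> real N * A"
    by (rule bounded_variation_along_path[OF assms(1) \<open>r / 3 > 0\<close>]) blast
  show ?thesis
  proof (rule that[of "exp (real N * ln 4)"])
    show "exp (real N * ln 4) \<ge> 1" by simp
    fix g z w
    assume hol: "g holomorphic_on UNIV"
      and big: "\<And>p x. p \<in> path_image \<gamma> \<Longrightarrow> x \<in> ball p r \<Longrightarrow> norm (g x) > 1"
      and zw: "z \<in> path_image \<gamma>" "w \<in> path_image \<gamma>"
    have pos: "ln (norm (g p)) > 0" if "p \<in> path_image \<gamma>" for p
      by (rule ln_gt_zero[OF big[OF that]]) (use \<open>r > 0\<close> in simp)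
    have "\<bar>ln (ln (norm (g z))) - ln (ln (norm (g w)))\<bar> \<le> real N * ln 4"
    proof (rule N(2)[where \<phi> = "\<lambda>p. ln (ln (norm (g p)))", OF _ zw])
      fix p q assume pq: "p \<in> path_image \<gamma>" "q \<in> path_image \<gamma>" "dist p q \<le> r / 3"
      have holb: "g holomorphic_on ball p r" using hol by (rule holomorphic_on_subset) simp
      have "ln (norm (g q)) \<le> 4 * ln (norm (g p))" "ln (norm (g p)) \<le> 4 * ln (norm (g q))"
        using harnack_ln_norm_two_points[OF holb big[OF pq(1)], of q "1/3" p]
          harnack_ln_norm_two_points[OF holb big[OF pq(1)], of p "1/3" q] pq(3) \<open>r > 0\<close> by simp_all
      then have "ln (ln (norm (g q))) \<le> ln (4 * ln (norm (g p)))"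
          "ln (ln (norm (g p))) \<le> ln (4 * ln (norm (g q)))"
        using pos[OF pq(1)] pos[OF pq(2)] by (simp_all add: ln_le_cancel_iff)
      then show "\<bar>ln (ln (norm (g q))) - ln (ln (norm (g p)))\<bar> \<le> ln 4"
        using pos[OF pq(1)] pos[OF pq(2)] by (simp add: ln_mult abs_le_iff)
    qed
    then have "ln (ln (norm (g z))) \<le> real N * ln 4 + ln (ln (norm (g w)))" by linarith
    then have "exp (ln (ln (norm (g z)))) \<le> exp (real N * ln 4 + ln (ln (norm (g w))))"
      by (rule iffD2[OF exp_le_cancel_iff])
    then show "ln (norm (g z)) \<le> exp (real N * ln 4) * ln (norm (g w))"
      using pos[OF zw(1)] pos[OF zw(2)] by (simp only: exp_add exp_ln)
  qed
qed

lemma oscillation_along_path_if_rays_omitted: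
  assumes "path \<gamma>" "r > 0"
  obtains A :: real where "A > 0"
    "\<And>g z w. g holomorphic_on UNIV
       \<Longrightarrow> (\<And>p. p \<in> path_image \<gamma> \<Longrightarrow> \<exists>e. e \<noteq> 0 \<and> (\<forall>x\<in>ball p r. \<forall>t\<ge>0. g x \<noteq> of_real t * e))
       \<Longrightarrow> z \<in> path_image \<gamma> \<Longrightarrow> w \<in> path_image \<gamma> \<Longrightarrow> ln (norm (g z)) \<le> ln (norm (g w)) + A"
proof -
  have "r / 2 > 0" using \<open>r > 0\<close> by simp
  obtain N :: nat where N: "N > 0"
    "\<And>\<phi> :: complex \<Rightarrow> real. \<And>A z w.
       (\<And>p q. p \<in> path_image \<gamma> \<Longrightarrow> q \<in> path_image \<gamma> \<Longrightarrow> dist p q \<le> r / 2 \<Longrightarrow> \<bar>\<phi> q - \<phi> p\<bar> \<le> A)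
       \<Longrightarrow> z \<in> path_image \<gamma> \<Longrightarrow> w \<in> path_image \<gamma> \<Longrightarrow> \<bar>\<phi> z - \<phi> w\<bar> \<le> real N * A"
    by (rule bounded_variation_along_path[OF assms(1) \<open>r / 2 > 0\<close>]) blast
  show ?thesis
  proof (rule that[of "real N * (4 * pi)"])
    show "real N * (4 * pi) > 0" using N(1) by simp
    fix g z w
    assume hol: "g holomorphic_on UNIV"
      and omit: "\<And>p. p \<in> path_image \<gamma> \<Longrightarrow> \<exists>e. e \<noteq> 0 \<and> (\<forall>x\<in>ball p r. \<forall>t\<ge>0. g x \<noteq> of_real t * e)"
      and zw: "z \<in> path_image \<gamma>" "w \<in> path_image \<gamma>"
    have "\<bar>ln (norm (g z)) - ln (norm (g w))\<bar> \<le> real N * (4 * pi)"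
    proof (rule N(2)[where \<phi> = "\<lambda>p. ln (norm (g p))", OF _ zw])
      fix p q assume pq: "p \<in> path_image \<gamma>" "q \<in> path_image \<gamma>" "dist p q \<le> r / 2"
      obtain e where e: "e \<noteq> 0" "\<And>x t. x \<in> ball p r \<Longrightarrow> t \<ge> 0 \<Longrightarrow> g x \<noteq> of_real t * e"
        using omit[OF pq(1)] by blast
      have "g holomorphic_on ball p r" using hol by (rule holomorphic_on_subset) simp
      then show "\<bar>ln (norm (g q)) - ln (norm (g p))\<bar> \<le> 4 * pi"
        by (rule ln_norm_oscillation_if_ray_omitted[OF _ e pq(3) \<open>r > 0\<close>])
    qed
    then show "ln (norm (g z)) \<le> ln (norm (g w)) + real N * (4 * pi)" by linarith
  qed
qed

text \<open>The hypothesis says \<open>s \<le> t powr (1 + 1 / (2 d))\<close>, and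
  \<open>(1 + 1 / (2 d)) (d - 1/2) = d - 1 / (4 d) < d\<close>. This product is why a logarithmic ratio close to
  \<open>1\<close>, depending on \<open>d\<close>, is needed between the two rays, while the constant \<open>C\<close> may be anything.\<close>

lemma ray_growth_gap:
  fixes c C :: real and d :: nat
  assumes "d > 0" "c > 0" "C > 0"
  shows "\<exists>X. \<forall>s t. s > 0 \<longrightarrow> t > X \<longrightarrow> ln s \<le> (1 + 1 / (2 * real d)) * ln t
           \<longrightarrow> C * s powr (real d - 1/2) < c * t ^ d"
proof -
  have "1 / (4 * real d) > 0" using \<open>d > 0\<close> by simp
  then have "filterlim (\<lambda>t::real. t powr (1 / (4 * real d))) at_top at_top" by real_asymp
  then have "\<forall>\<^sub>F t::real in at_top. C / c < t powr (1 / (4 * real d))"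
    by (simp add: filterlim_at_top_dense)
  with eventually_gt_at_top[of "0::real"]
  have "\<forall>\<^sub>F t::real in at_top. 0 < t \<and> C / c < t powr (1 / (4 * real d))"
    by eventually_elim simp
  then obtain X where X: "\<And>t. t \<ge> X \<Longrightarrow> 0 < t \<and> C / c < t powr (1 / (4 * real d))"
    unfolding eventually_at_top_linorder by blast
  have "C * s powr (real d - 1/2) < c * t ^ d"
    if s: "s > 0" and t: "t > X" and st: "ln s \<le> (1 + 1 / (2 * real d)) * ln t" for s t
  proof -
    have t0: "t > 0" "C < c * t powr (1 / (4 * real d))"
      using X[of t] t \<open>c > 0\<close> by (simp_all add: field_simps)
    have "(real d - 1/2) * ln s \<le> (real d - 1/2) * ((1 + 1 / (2 * real d)) * ln t)"
      using st \<open>d > 0\<close> by (intro mult_left_mono) auto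
    also have "\<dots> = (real d - 1 / (4 * real d)) * ln t" using \<open>d > 0\<close> by (simp add: field_simps)
    finally have "s powr (real d - 1/2) \<le> t powr (real d - 1 / (4 * real d))"
      using s t0(1) by (simp add: powr_def)
    then have "C * s powr (real d - 1/2) \<le> C * t powr (real d - 1 / (4 * real d))"
      using \<open>C > 0\<close> by simp
    also have "\<dots> < c * t powr (1 / (4 * real d)) * t powr (real d - 1 / (4 * real d))"
      using t0 by (intro mult_strict_right_mono) auto
    also have "\<dots> = c * t powr (real d)" by (simp only: mult.assoc flip: powr_add) simp
    also have "\<dots> = c * t ^ d" using t0(1) by (simp add: powr_realpow)
    finally show ?thesis .
  qed
  then show ?thesis by blast
qed

section \<open>Multiply connected escaping components\<close>

text \<open>Take a loop in \<open>W\<close> around a point outside \<open>W\<close> and a large \<open>n\<close> for which \<open>f ^^ n\<close> has a zero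
  inside. The image of the loop meets both rays. If some small ball centred on the loop is mapped so as
  to meet both rays, Harnack's inequality on this ball compares the two points with a constant near \<open>1\<close>. If
  instead each small ball misses one of the rays, then \<open>ln (norm (f ^^ n))\<close> varies boundedly along
  the loop, which again gives a ratio near \<open>1\<close> because the logarithms themselves are large. In both
  cases \<open>f\<close> sends two points at comparable places of the rays to images whose logarithms are
  comparable, and this contradicts the growth of \<open>f\<close>.\<close>

lemma no_multiply_connected_escaping_component:
  fixes f :: "complex \<Rightarrow> complex"
  assumes hol: "f holomorphic_on UNIV" and W: "fatou_component f W" "multiply_connected W"
    and esc: "\<And>z. z \<in> W \<Longrightarrow> filterlim (\<lambda>n. (f ^^ n) z) at_infinity sequentially"
    and d: "d > 0" and c: "c > 0" and e: "norm e1 = 1" "norm e2 = 1"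
    and large: "\<forall>\<^sub>F t in at_top. exp (c * t ^ d) \<le> norm (f (of_real t * e1))"
    and small: "\<forall>\<^sub>F t in at_top. norm (f (of_real t * e2)) \<le> exp (t powr (real d - 1/2))"
  shows False
proof -
  have comp: "W \<in> components (fatou_set f)" using W(1) by (simp add: fatou_component_def)
  have opW: "open W" using open_components[OF open_fatou_set comp] .
  obtain \<gamma> \<Omega> where \<gamma>: "path \<gamma>" "path_image \<gamma> \<subseteq> W"
      and \<Omega>: "open \<Omega>" "connected \<Omega>" "bounded \<Omega>" "frontier \<Omega> \<subseteq> path_image \<gamma>" "\<not> \<Omega> \<subseteq> W"
    using multiply_connected_surrounded_point[OF opW W(2)] .
  let ?K = "path_image \<gamma>"
  obtain r where r: "r > 0" "(\<Union>x\<in>?K. cball x r) \<subseteq> W"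
    using compact_subset_open_imp_cball_epsilon_subset[OF compact_path_image[OF \<gamma>(1)] opW \<gamma>(2)] .
  define V where "V = {x + y | x y. x \<in> ?K \<and> y \<in> cball 0 r}"
  have V: "compact V" unfolding V_def by (intro compact_sums compact_path_image \<gamma>(1) compact_cball)
  have ballV: "x \<in> V" if "p \<in> ?K" "dist p x \<le> r" for p x
  proof -
    have "x = p + (x - p)" "x - p \<in> cball 0 r"
      using that(2) by (simp_all add: dist_norm norm_minus_commute)
    with that(1) show ?thesis unfolding V_def by blast
  qed
  have VW: "V \<subseteq> W"
  proof
    fix v assume "v \<in> V"
    then obtain x y where "x \<in> ?K" "norm y \<le> r" "v = x + y" unfolding V_def by auto
    then have "v \<in> cball x r" by (simp add: dist_norm)
    with \<open>x \<in> ?K\<close> r(2) show "v \<in> W" by blast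
  qed
  \<comment> \<open>With this radius the two-point constant is the exponent ratio of the growth gap.\<close>
  define \<rho> where "\<rho> = 1 / (18 * real d)"
  have \<rho>: "\<rho> > 0" "\<rho> \<le> 1/3" "9 * \<rho> = 1 / (2 * real d)" using d by (auto simp: \<rho>_def field_simps)
  have "\<rho> * r > 0" "\<rho> * r \<le> r" using \<rho> r(1) by simp_all
  have holn: "(f ^^ n) holomorphic_on A" for n A by (rule holomorphic_iterate[OF hol])
  obtain C where C: "C \<ge> 1"
    "\<And>g z w. g holomorphic_on UNIV \<Longrightarrow> (\<And>p x. p \<in> ?K \<Longrightarrow> x \<in> ball p r \<Longrightarrow> norm (g x) > 1)
       \<Longrightarrow> z \<in> ?K \<Longrightarrow> w \<in> ?K \<Longrightarrow> ln (norm (g z)) \<le> C * ln (norm (g w))"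
    by (rule harnack_along_path[OF \<gamma>(1) r(1)]) blast
  obtain A where A: "A > 0"
    "\<And>g z w. g holomorphic_on UNIV
       \<Longrightarrow> (\<And>p. p \<in> ?K \<Longrightarrow> \<exists>e. e \<noteq> 0 \<and> (\<forall>x\<in>ball p (\<rho> * r). \<forall>t\<ge>0. g x \<noteq> of_real t * e))
       \<Longrightarrow> z \<in> ?K \<Longrightarrow> w \<in> ?K \<Longrightarrow> ln (norm (g z)) \<le> ln (norm (g w)) + A"
    by (rule oscillation_along_path_if_rays_omitted[OF \<gamma>(1) \<open>\<rho> * r > 0\<close>]) blast
  \<comment> \<open>One constant for both the short-range and the long-range comparison.\<close>
  define C' where "C' = C + 1 + 9 * \<rho>"
  have C': "C' > 0" "C \<le> C'" "1 + 9 * \<rho> \<le> C'" using C(1) \<rho>(1) by (auto simp: C'_def)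
  obtain X0 where X0: "\<And>s t. s > 0 \<Longrightarrow> t > X0 \<Longrightarrow> ln s \<le> (1 + 1 / (2 * real d)) * ln t
           \<Longrightarrow> C' * s powr (real d - 1/2) < c * t ^ d"
    using ray_growth_gap[OF d c C'(1)] by blast
  obtain X1 where X1: "\<And>t. t \<ge> X1 \<Longrightarrow> exp (c * t ^ d) \<le> norm (f (of_real t * e1))"
    using large unfolding eventually_at_top_linorder by blast
  obtain X2 where X2: "\<And>t. t \<ge> X2 \<Longrightarrow> norm (f (of_real t * e2)) \<le> exp (t powr (real d - 1/2))"
    using small unfolding eventually_at_top_linorder by blast
  \<comment> \<open>The last entry makes the bounded variation \<open>A\<close> at most \<open>1 / (2 d)\<close> times \<open>ln t\<close> for
    \<open>t > X\<close>.\<close>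
  define X where "X = Max {1, X0, X1, X2, exp (A * (2 * real d))}"
  have X: "X \<ge> 1" "X \<ge> X0" "X \<ge> X1" "X \<ge> X2" "X \<ge> exp (A * (2 * real d))" by (simp_all add: X_def)
  have ev: "\<forall>\<^sub>F n in sequentially. \<forall>w\<in>V. X < norm ((f ^^ n) w)"
    by (rule escape_uniform_on_compact[OF W(1) esc V VW])
  then have "\<forall>\<^sub>F n in sequentially. \<forall>w\<in>V. X < norm ((f ^^ Suc n) w)"
    by (subst eventually_sequentially_Suc)
  with ev have ev2: "\<forall>\<^sub>F n in sequentially. (\<forall>w\<in>V. X < norm ((f ^^ n) w)) \<and> (\<forall>w\<in>V. X < norm ((f ^^ Suc n) w))"
    by (rule eventually_conj)
  have "\<not> (\<forall>\<^sub>F n in sequentially. \<forall>z\<in>\<Omega>. (f ^^ n) z \<noteq> 0)"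
    using escaping_component_fills_bounded_open[OF hol W(1) esc \<Omega>(1-3)] \<Omega>(4,5) \<gamma>(2) by blast
  then have "\<exists>\<^sub>F n in sequentially. \<exists>z\<in>\<Omega>. (f ^^ n) z = 0" by (simp add: frequently_def)
  from frequently_ex[OF frequently_eventually_conj[OF this ev2]]
  obtain n z0 where n: "\<And>w. w \<in> V \<Longrightarrow> X < norm ((f ^^ n) w)"
    "\<And>w. w \<in> V \<Longrightarrow> X < norm ((f ^^ Suc n) w)" and z0: "z0 \<in> \<Omega>" "(f ^^ n) z0 = 0" by blast
  have big: "norm ((f ^^ k) x) > 1" if "k \<in> {n, Suc n}" "p \<in> ?K" "x \<in> ball p r" for k p x
    using n[OF ballV[OF that(2), of x]] that X(1) by fastforce
  have KV: "?K \<subseteq> V" using ballV r(1) by force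
  have near: "ln (norm ((f ^^ k) z)) \<le> (1 + 9 * \<rho>) * ln (norm ((f ^^ k) w))"
    if "k \<in> {n, Suc n}" "p \<in> ?K" "dist p z \<le> \<rho> * r" "dist p w \<le> \<rho> * r" for k p z w
    by (rule harnack_ln_norm_two_points[OF holn big[OF that(1,2)] that(3,4) r(1) \<rho>(1,2)])
  have "\<exists>z1\<in>V. \<exists>z2\<in>V. \<exists>s\<ge>0. \<exists>t\<ge>0. (f ^^ n) z1 = of_real s * e2 \<and> (f ^^ n) z2 = of_real t * e1 \<and>
      ln s \<le> (1 + 9 * \<rho>) * ln t \<and>
      ln (norm ((f ^^ Suc n) z2)) \<le> C' * ln (norm ((f ^^ Suc n) z1))"
  proof (cases "\<exists>p\<in>?K. \<exists>z1\<in>ball p (\<rho> * r). \<exists>z2\<in>ball p (\<rho> * r). \<exists>s\<ge>0. \<exists>t\<ge>0.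
                  (f ^^ n) z1 = of_real s * e2 \<and> (f ^^ n) z2 = of_real t * e1")
    case True
    then obtain p z1 z2 s t where p0: "p \<in> ?K" "z1 \<in> ball p (\<rho> * r)" "z2 \<in> ball p (\<rho> * r)" "s \<ge> 0" "t \<ge> 0"
      and st: "(f ^^ n) z1 = of_real s * e2" "(f ^^ n) z2 = of_real t * e1"
      by blast
    then have p: "p \<in> ?K" "dist p z1 \<le> \<rho> * r" "dist p z2 \<le> \<rho> * r" "s \<ge> 0" "t \<ge> 0" by simp_all
    have zV: "z1 \<in> V" "z2 \<in> V" using p \<open>\<rho> * r \<le> r\<close> by (auto intro!: ballV[OF p(1)])
    have ln1: "ln s \<le> (1 + 9 * \<rho>) * ln t"
      using near[of n p z1 z2] p st e by (simp add: norm_mult)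
    have ln2: "ln (norm ((f ^^ Suc n) z2)) \<le> C' * ln (norm ((f ^^ Suc n) z1))"
    proof -
      have "ln (norm ((f ^^ Suc n) z2)) \<le> (1 + 9 * \<rho>) * ln (norm ((f ^^ Suc n) z1))"
        using near[of "Suc n" p z2 z1] p by blast
      also have "\<dots> \<le> C' * ln (norm ((f ^^ Suc n) z1))"
        using C'(3) n(2)[OF zV(1)] X(1) by (intro mult_right_mono ln_ge_zero) linarith+
      finally show ?thesis .
    qed
    show ?thesis
      by (intro bexI[of _ z1] bexI[of _ z2] exI[of _ s] exI[of _ t] conjI) (fact zV p st ln1 ln2)+
  next
    case False
    have hit: "\<exists>w\<in>frontier \<Omega>. \<exists>t>0. (f ^^ n) w = of_real t * e'" if "norm e' = 1" for e'
    proof (rule holomorphic_image_frontier_hits_ray[OF holn \<Omega>(1-3) z0])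
      show "e' \<noteq> 0" using that by auto
      fix w assume "w \<in> frontier \<Omega>"
      then have "X < norm ((f ^^ n) w)" using n(1) \<Omega>(4) KV by blast
      then show "(f ^^ n) w \<noteq> 0" using X(1) by auto
    qed
    obtain z1 s where z1: "z1 \<in> ?K" "s > 0" "(f ^^ n) z1 = of_real s * e2"
      using hit[OF e(2)] \<Omega>(4) by blast
    obtain z2 t where z2: "z2 \<in> ?K" "t > 0" "(f ^^ n) z2 = of_real t * e1"
      using hit[OF e(1)] \<Omega>(4) by blast
    have "ln (norm ((f ^^ n) z1)) \<le> ln (norm ((f ^^ n) z2)) + A"
    proof (rule A(2)[OF holn _ z1(1) z2(1)])
      fix p assume "p \<in> ?K"
      then have "(\<forall>x\<in>ball p (\<rho> * r). \<forall>t\<ge>0. (f ^^ n) x \<noteq> of_real t * e1) \<or>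
                 (\<forall>x\<in>ball p (\<rho> * r). \<forall>t\<ge>0. (f ^^ n) x \<noteq> of_real t * e2)"
        using False by blast
      moreover have "e1 \<noteq> 0" "e2 \<noteq> 0" using e by auto
      ultimately show "\<exists>e. e \<noteq> 0 \<and> (\<forall>x\<in>ball p (\<rho> * r). \<forall>t\<ge>0. (f ^^ n) x \<noteq> of_real t * e)" by blast
    qed
    then have "ln s \<le> ln t + A" using z1 z2 e by (simp add: norm_mult)
    moreover have "A \<le> 9 * \<rho> * ln t"
    proof -
      have "norm ((f ^^ n) z2) = t" using z2 e by (simp add: norm_mult)
      then have "X < t" using n(1)[of z2] z2(1) KV by auto
      then have "exp (A * (2 * real d)) \<le> t" using X(5) by linarith
      then have "A * (2 * real d) \<le> ln t" using z2(2) by (simp add: ln_ge_iff)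
      then show ?thesis unfolding \<rho>(3) using d by (simp add: field_simps)
    qed
    ultimately have ln1: "ln s \<le> (1 + 9 * \<rho>) * ln t" by (simp add: algebra_simps)
    have ln2: "ln (norm ((f ^^ Suc n) z2)) \<le> C' * ln (norm ((f ^^ Suc n) z1))"
    proof -
      have "ln (norm ((f ^^ Suc n) z2)) \<le> C * ln (norm ((f ^^ Suc n) z1))"
        by (rule C(2)[OF holn big z2(1) z1(1)]) auto
      also have "\<dots> \<le> C' * ln (norm ((f ^^ Suc n) z1))"
        using C'(2) n(2)[of z1] z1(1) KV X(1) by (intro mult_right_mono ln_ge_zero) auto
      finally show ?thesis .
    qed
    have zV: "z1 \<in> V" "z2 \<in> V" "s \<ge> 0" "t \<ge> 0" using z1 z2 KV by auto
    show ?thesis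
      by (intro bexI[of _ z1] bexI[of _ z2] exI[of _ s] exI[of _ t] conjI) (fact zV z1(3) z2(3) ln1 ln2)+
  qed
  then obtain z1 z2 s t where z: "z1 \<in> V" "z2 \<in> V" "s \<ge> 0" "t \<ge> 0"
    and st: "(f ^^ n) z1 = of_real s * e2" "(f ^^ n) z2 = of_real t * e1"
    and lnst: "ln s \<le> (1 + 9 * \<rho>) * ln t"
    and lnf: "ln (norm ((f ^^ Suc n) z2)) \<le> C' * ln (norm ((f ^^ Suc n) z1))" by blast
  have "norm ((f ^^ n) z1) = s" "norm ((f ^^ n) z2) = t" using st z e by (simp_all add: norm_mult)
  then have sX: "s > X" and tX: "t > X" using n(1)[OF z(1)] n(1)[OF z(2)] by simp_all
  have fz: "(f ^^ Suc n) z1 = f (of_real s * e2)" "(f ^^ Suc n) z2 = f (of_real t * e1)"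
    by (simp_all add: st)
  have pos: "norm (f (of_real s * e2)) > 0" "norm (f (of_real t * e1)) > 0"
    using n(2)[OF z(1)] n(2)[OF z(2)] X(1) unfolding fz by linarith+
  have "c * t ^ d \<le> ln (norm (f (of_real t * e1)))"
    using X1[of t] tX X(3) pos(2) by (simp add: ln_ge_iff)
  also have "\<dots> \<le> C' * ln (norm (f (of_real s * e2)))" using lnf unfolding fz .
  also have "\<dots> \<le> C' * s powr (real d - 1/2)"
  proof (rule mult_left_mono)
    have "norm (f (of_real s * e2)) \<le> exp (s powr (real d - 1/2))" using X2[of s] sX X(4) by simp
    then show "ln (norm (f (of_real s * e2))) \<le> s powr (real d - 1/2)"
      using pos(1) by (metis ln_exp ln_le_cancel_iff exp_gt_zero)
  qed (use C' in simp)
  also have "\<dots> < c * t ^ d" using X0[of s t] sX tX X lnst unfolding \<rho>(3) by simp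
  finally show False by simp
qed

theorem theorem5p2:
  fixes l :: nat and P Q :: "nat \<Rightarrow> complex poly"
  assumes "l \<ge> 2"
    and "\<And>i. i \<in> {1..l} \<Longrightarrow> P i \<noteq> 0"
    and "\<And>i. i \<in> {1..l-1} \<Longrightarrow> degree (Q i) > 0"
    and "\<And>i j. i \<in> {1..l-1} \<Longrightarrow> j \<in> {1..l-1} \<Longrightarrow> i \<noteq> j \<Longrightarrow> degree (Q i) \<noteq> degree (Q j)"
  shows "\<not> (\<exists>W. baker_wandering_domain
           (\<lambda>z. (\<Sum>i=1..l-1. poly (P i) z * exp (poly (Q i) z)) + poly (P l) z) W)"
proof
  let ?f = "\<lambda>z. (\<Sum>i=1..l-1. poly (P i) z * exp (poly (Q i) z)) + poly (P l) z"
  assume "\<exists>W. baker_wandering_domain ?f W"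
  then obtain W where W: "baker_wandering_domain ?f W" by blast
  have comp: "fatou_component ?f W"
    using W by (simp add: baker_wandering_domain_def wandering_domain_def)
  have "fatou_image ?f W 0 = W" by (rule fatou_image_0[OF comp])
  moreover have "multiply_connected (fatou_image ?f W 0)"
    using W unfolding baker_wandering_domain_def by blast
  ultimately have mc: "multiply_connected W" by (simp only:)
  let ?I = "{1..l-1}"
  have I: "finite ?I" "?I \<noteq> {}" using \<open>l \<ge> 2\<close> by auto
  obtain m where m: "m \<in> ?I" "\<And>i. i \<in> ?I \<Longrightarrow> degree (Q i) \<le> degree (Q m)"
  proof -
    have "Max ((\<lambda>i. degree (Q i)) ` ?I) \<in> (\<lambda>i. degree (Q i)) ` ?I"
      using I by (intro Max_in) auto
    then obtain m where "m \<in> ?I" "Max ((\<lambda>i. degree (Q i)) ` ?I) = degree (Q m)" by blast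
    moreover have "degree (Q i) \<le> Max ((\<lambda>i. degree (Q i)) ` ?I)" if "i \<in> ?I" for i
      using I that by (intro Max_ge) auto
    ultimately show thesis by (intro that[of m]) simp_all
  qed
  define d where "d = degree (Q m)"
  let ?a = "lead_coeff (Q m)"
  have d: "d > 0" using assms(3)[OF m(1)] by (simp add: d_def)
  have a: "?a \<noteq> 0" using d by (auto simp: d_def)
  have less: "degree (Q i) < d" if "i \<in> ?I - {m}" for i
    using m(2)[of i] assms(4)[of i m] m(1) that by (auto simp: d_def le_less)
  have Pm: "P m \<noteq> 0" using assms(2)[of m] m(1) unfolding atLeastAtMost_iff by linarith
  \<comment> \<open>The directions in which the leading term of \<open>Q m\<close> is positive and negative.\<close>
  obtain e1 where e1: "norm e1 = 1" "?a * e1 ^ d = of_real (norm ?a)"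
    using unit_direction_of_leading_coeff[OF d a norm_one] unfolding mult_1_right by blast
  obtain e2 where e2: "norm e2 = 1" "?a * e2 ^ d = of_real (- norm ?a)"
    using unit_direction_of_leading_coeff[OF d a, of "-1"] by force
  show False
  proof (rule no_multiply_connected_escaping_component[of ?f W d "norm ?a / 2" e1 e2])
    show "?f holomorphic_on UNIV" by (intro holomorphic_intros)
    show "filterlim (\<lambda>n. (?f ^^ n) z) at_infinity sequentially" if "z \<in> W" for z
      using W that by (simp add: baker_wandering_domain_def)
    show "\<forall>\<^sub>F t in at_top. exp (norm ?a / 2 * t ^ d) \<le> norm (?f (of_real t * e1))"
      by (rule exp_sum_large_on_ray[where P = P and Q = Q and R = "P l", OF I(1) m(1) e1(1) d_def[symmetric] d Pm less e1(2)]) (use a in auto)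
    show "\<forall>\<^sub>F t in at_top. norm (?f (of_real t * e2)) \<le> exp (t powr (real d - 1/2))"
      by (rule exp_sum_small_on_decay_ray[where P = P and Q = Q and R = "P l", OF I(1) m(1) e2(1) d_def[symmetric] d less e2(2)]) (use a in auto)
  qed (use comp mc d a e1 e2 in auto)
qed

end
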